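(* If $Q$ is a finite skew brace, then the exponent of the Schur multiplier $M_b(Q)$ divides $|Q|^2$.
   Context: A skew brace is a triple $(A,+,\circ)$ where $(A,+)$ and $(A,\circ)$ are (not necessarily abelian) groups with $a\circ(b+c)=a\circ b-a+a\circ c$ for all $a,b,c\in A$. Both groups have the same neutral element $0$. For a skew brace $Q$ and a (multiplicative) abelian group $K$, a factor set is a pair $(\alpha,\mu)$ of maps $Q\times Q\to K$ such that for all $x,y,z\in Q$: $\alpha(0,y)=\alpha(x,0)=1$, $\mu(0,y)=\mu(x,0)=1$, $\alpha(y,z)\alpha(x+y,z)^{-1}\alpha(x,y+z)\alpha(x,y)^{-1}=1$, $\mu(y,z)\mu(x\circ y,z)^{-1}\mu(x,y\circ z)\mu(x,y)^{-1}=1$, and $\alpha(y,z)\mu(x,y+z)\alpha(-x,x)=\mu(x,z)\alpha(x\circ y,-x)\alpha(x\circ y-x,x\circ z)\mu(x,y)$. Factor sets form a group $Z^2_b(Q,K)$ under pointwise multiplication. For $h:Q\to K$ put $\partial_+h(x,y)=h(y)h(x+y)^{-1}h(x)$ and $\partial_\circ h(x,y)=h(y)h(x\circ y)^{-1}h(x)$. Let $B^2_b(Q,K)=\{(\partial_+h,\partial_\circ h): h:Q\to K,\ h(0)=1\}$ and $H^2_b(Q,K)=Z^2_b(Q,K)/B^2_b(Q,K)$. The Schur multiplier of a finite skew brace $Q$ is $M_b(Q)=H^2_b(Q,\mathbb{C}^\times)$. *)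

theory Defs
  imports
    Complex_Main
    "HOL-Algebra.Product_Groups"
    "HOL-Algebra.Algebraic_Closure_Type"
begin

text \<open>
  A skew brace is carried by the record type of rings: \<open>\<oplus>\<close>, \<open>\<zero>\<close>, \<open>\<ominus>\<close> denote the (not necessarily
  commutative) additive group, and \<open>\<otimes>\<close>, \<open>\<one>\<close>, \<open>inv\<close> the circle group.  That \<open>\<zero>\<close> and \<open>\<one>\<close> coincide is
  a consequence of the axioms.
\<close>

locale skew_brace =
  fixes Q :: "('a, 'm) ring_scheme" (structure)
  assumes additive_group: "group (add_monoid Q)"
    and circle_group: "group Q"
    and brace: "\<lbrakk>a \<in> carrier Q; b \<in> carrier Q; c \<in> carrier Q\<rbrakk>
      \<Longrightarrow> a \<otimes> (b \<oplus> c) = ((a \<otimes> b) \<ominus> a) \<oplus> (a \<otimes> c)"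

lemma (in skew_brace) zero_eq_one: "\<zero> = \<one>"
proof -
  interpret A: group "add_monoid Q" by (rule additive_group)
  interpret M: group Q by (rule circle_group)
  have z: "\<zero> \<in> carrier Q" using A.one_closed by simp
  have "\<one> \<otimes> (\<one> \<oplus> \<one>) = ((\<one> \<otimes> \<one>) \<ominus> \<one>) \<oplus> (\<one> \<otimes> \<one>)"
    by (rule brace) auto
  moreover have "\<one> \<ominus> \<one> = \<zero>"
    using A.r_inv[of \<one>] by (simp add: a_minus_def a_inv_def)
  moreover have "\<zero> \<oplus> \<one> = \<one>" using A.l_one[of \<one>] by simp
  moreover have "\<one> \<oplus> \<one> \<in> carrier Q" using A.m_closed[of \<one> \<one>] by simp
  ultimately have "\<one> \<oplus> \<one> = \<one>" by simp
  then show ?thesis using A.l_cancel_one[of \<one> \<one>] by simp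
qed

text \<open>
  Maps \<open>Q \<times> Q \<rightarrow> K\<close> are represented by extensional functions on \<^term>\<open>carrier Q \<times> carrier Q\<close>, so that
  equality of functions is equality of the maps.
\<close>

definition factor_sets ::
  "('a, 'm) ring_scheme \<Rightarrow> ('k, 'n) monoid_scheme \<Rightarrow> (('a \<times> 'a \<Rightarrow> 'k) \<times> ('a \<times> 'a \<Rightarrow> 'k)) set" where
  "factor_sets Q K = {(\<alpha>, \<mu>).
     \<alpha> \<in> carrier Q \<times> carrier Q \<rightarrow>\<^sub>E carrier K \<and>
     \<mu> \<in> carrier Q \<times> carrier Q \<rightarrow>\<^sub>E carrier K \<and>
     (\<forall>x \<in> carrier Q. \<forall>y \<in> carrier Q. \<forall>z \<in> carrier Q.
       \<alpha> (\<zero>\<^bsub>Q\<^esub>, y) = \<one>\<^bsub>K\<^esub> \<and> \<alpha> (x, \<zero>\<^bsub>Q\<^esub>) = \<one>\<^bsub>K\<^esub> \<and>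
       \<mu> (\<zero>\<^bsub>Q\<^esub>, y) = \<one>\<^bsub>K\<^esub> \<and> \<mu> (x, \<zero>\<^bsub>Q\<^esub>) = \<one>\<^bsub>K\<^esub> \<and>
       \<alpha> (y, z) \<otimes>\<^bsub>K\<^esub> inv\<^bsub>K\<^esub> \<alpha> (x \<oplus>\<^bsub>Q\<^esub> y, z) \<otimes>\<^bsub>K\<^esub> \<alpha> (x, y \<oplus>\<^bsub>Q\<^esub> z) \<otimes>\<^bsub>K\<^esub> inv\<^bsub>K\<^esub> \<alpha> (x, y) = \<one>\<^bsub>K\<^esub> \<and>
       \<mu> (y, z) \<otimes>\<^bsub>K\<^esub> inv\<^bsub>K\<^esub> \<mu> (x \<otimes>\<^bsub>Q\<^esub> y, z) \<otimes>\<^bsub>K\<^esub> \<mu> (x, y \<otimes>\<^bsub>Q\<^esub> z) \<otimes>\<^bsub>K\<^esub> inv\<^bsub>K\<^esub> \<mu> (x, y) = \<one>\<^bsub>K\<^esub> \<and>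
       \<alpha> (y, z) \<otimes>\<^bsub>K\<^esub> \<mu> (x, y \<oplus>\<^bsub>Q\<^esub> z) \<otimes>\<^bsub>K\<^esub> \<alpha> (\<ominus>\<^bsub>Q\<^esub> x, x) =
         \<mu> (x, z) \<otimes>\<^bsub>K\<^esub> \<alpha> (x \<otimes>\<^bsub>Q\<^esub> y, \<ominus>\<^bsub>Q\<^esub> x) \<otimes>\<^bsub>K\<^esub> \<alpha> ((x \<otimes>\<^bsub>Q\<^esub> y) \<ominus>\<^bsub>Q\<^esub> x, x \<otimes>\<^bsub>Q\<^esub> z) \<otimes>\<^bsub>K\<^esub> \<mu> (x, y))}"

definition Z2b ::
  "('a, 'm) ring_scheme \<Rightarrow> ('k, 'n) monoid_scheme \<Rightarrow> (('a \<times> 'a \<Rightarrow> 'k) \<times> ('a \<times> 'a \<Rightarrow> 'k)) monoid" where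
  "Z2b Q K =
     (product_group (carrier Q \<times> carrier Q) (\<lambda>_. K) \<times>\<times> product_group (carrier Q \<times> carrier Q) (\<lambda>_. K))
       \<lparr>carrier := factor_sets Q K\<rparr>"

definition d_add ::
  "('a, 'm) ring_scheme \<Rightarrow> ('k, 'n) monoid_scheme \<Rightarrow> ('a \<Rightarrow> 'k) \<Rightarrow> 'a \<times> 'a \<Rightarrow> 'k" where
  "d_add Q K h =
     (\<lambda>(x, y) \<in> carrier Q \<times> carrier Q. h y \<otimes>\<^bsub>K\<^esub> inv\<^bsub>K\<^esub> h (x \<oplus>\<^bsub>Q\<^esub> y) \<otimes>\<^bsub>K\<^esub> h x)"

definition d_circ ::
  "('a, 'm) ring_scheme \<Rightarrow> ('k, 'n) monoid_scheme \<Rightarrow> ('a \<Rightarrow> 'k) \<Rightarrow> 'a \<times> 'a \<Rightarrow> 'k" where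
  "d_circ Q K h =
     (\<lambda>(x, y) \<in> carrier Q \<times> carrier Q. h y \<otimes>\<^bsub>K\<^esub> inv\<^bsub>K\<^esub> h (x \<otimes>\<^bsub>Q\<^esub> y) \<otimes>\<^bsub>K\<^esub> h x)"

definition B2b ::
  "('a, 'm) ring_scheme \<Rightarrow> ('k, 'n) monoid_scheme \<Rightarrow> (('a \<times> 'a \<Rightarrow> 'k) \<times> ('a \<times> 'a \<Rightarrow> 'k)) set" where
  "B2b Q K = {(d_add Q K h, d_circ Q K h) | h. h \<in> carrier Q \<rightarrow> carrier K \<and> h \<zero>\<^bsub>Q\<^esub> = \<one>\<^bsub>K\<^esub>}"

definition H2b ::
  "('a, 'm) ring_scheme \<Rightarrow> ('k, 'n) monoid_scheme \<Rightarrow> (('a \<times> 'a \<Rightarrow> 'k) \<times> ('a \<times> 'a \<Rightarrow> 'k)) set monoid" where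
  "H2b Q K = Z2b Q K Mod B2b Q K"

definition Schur_multiplier ::
  "('a, 'm) ring_scheme \<Rightarrow> (('a \<times> 'a \<Rightarrow> complex) \<times> ('a \<times> 'a \<Rightarrow> complex)) set monoid" where
  "Schur_multiplier Q = H2b Q (units_of (ring_of_type_algebra :: complex ring))"

text \<open>
  The exponent of a group without a common positive period is \<open>0\<close>, which divides no positive number.
\<close>

definition group_exponent :: "('g, 'n) monoid_scheme \<Rightarrow> nat" where
  "group_exponent G =
     (if \<exists>n::nat. n > 0 \<and> (\<forall>x \<in> carrier G. x [^]\<^bsub>G\<^esub> n = \<one>\<^bsub>G\<^esub>)
      then LEAST n::nat. n > 0 \<and> (\<forall>x \<in> carrier G. x [^]\<^bsub>G\<^esub> n = \<one>\<^bsub>G\<^esub>)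
      else 0)"

end

(*
  Multiplying the additive cocycle identity over its first argument x shows that
  \<alpha>^|Q| = \<partial>_+ h for h(y) = \<Prod>_x \<alpha>(x, y).  Hence (\<alpha>, \<mu>)^|Q| is cohomologous to a factor set (1, \<mu>').
  For such a factor set the compatibility condition says that \<mu>'(x, -) is a homomorphism from
  (Q, +) to K, so that \<mu>'^|Q| = 1.  Therefore (\<alpha>, \<mu>)^(|Q|^2) is a coboundary.  The argument works for
  every abelian group K of coefficients.
*)
theory Submission
  imports Defs
begin

section \<open>Group exponents and identities in abelian groups\<close>

lemma (in group) group_exponent_dvd:
  fixes n :: nat
  assumes "n > 0" and pow: "\<And>x. x \<in> carrier G \<Longrightarrow> x [^] n = \<one>"
  shows "group_exponent G dvd n"
proof -
  define P where "P m \<longleftrightarrow> m > 0 \<and> (\<forall>x \<in> carrier G. x [^] m = \<one>)" for m :: nat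
  have "P n" using assms by (simp add: P_def)
  then have "\<exists>m. P m" by blast
  then have eq: "group_exponent G = (LEAST m. P m)"
    unfolding group_exponent_def P_def by (rule if_P)
  define e where "e = (LEAST m. P m)"
  have e: "P e" and le: "\<And>m. P m \<Longrightarrow> e \<le> m"
    using \<open>P n\<close> by (auto simp: e_def intro: LeastI Least_le)
  \<comment> \<open>Division with remainder: \<open>n mod e\<close> also annihilates every element
    and is smaller than the least positive period \<open>e\<close>, so it can only be 0.\<close>
  have "x [^] (n mod e) = \<one>" if x: "x \<in> carrier G" for x
  proof -
    have "\<one> = x [^] (e * (n div e) + n mod e)" using pow[OF x] by simp
    also have "\<dots> = x [^] (e * (n div e)) \<otimes> x [^] (n mod e)"
      using x by (simp only: nat_pow_mult)
    also have "x [^] (e * (n div e)) = (x [^] e) [^] (n div e)"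
      using x by (simp only: nat_pow_pow)
    also have "\<dots> = \<one>" using e x by (simp add: P_def)
    finally show ?thesis using x by simp
  qed
  then have "n mod e = 0"
    using le[of "n mod e"] e mod_less_divisor[of e n] unfolding P_def
    by (meson leD neq0_conv)
  then show ?thesis using eq e_def by auto
qed

text \<open>This serves to replace the cocycle conditions, stated with inverses, by equations
  between products, which can be multiplied and inverted factor by factor.\<close>

lemma (in comm_group) mult_inv_eq_one_iff:
  assumes "a \<in> carrier G" "b \<in> carrier G" "c \<in> carrier G" "d \<in> carrier G"
  shows "a \<otimes> inv b \<otimes> c \<otimes> inv d = \<one> \<longleftrightarrow> a \<otimes> c = b \<otimes> d"
proof -
  have "a \<otimes> inv b \<otimes> c \<otimes> inv d = (a \<otimes> c) \<otimes> inv (b \<otimes> d)"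
    using assms by (simp add: inv_mult m_ac)
  then show ?thesis
    using assms by (metis inv_closed inv_inv inv_equality m_closed r_inv)
qed

lemma (in comm_group) inv_mult_inv_cong:
  assumes "a \<in> carrier G" "b \<in> carrier G" "c \<in> carrier G" "d \<in> carrier G"
    "a \<otimes> c = b \<otimes> d"
  shows "inv a \<otimes> inv c = inv b \<otimes> inv d"
  using assms by (simp flip: inv_mult)

section \<open>Factor sets with coefficients in an arbitrary abelian group\<close>

locale brace_coefficients = skew_brace Q + K: comm_group K
  for Q :: "('a, 'm) ring_scheme" (structure) and K :: "('k, 'n) monoid_scheme"
begin

text \<open>The rewrites turn the group facts about \<open>add_monoid Q\<close> into facts about
  \<open>\<oplus>\<close>, \<open>\<zero>\<close> and \<open>\<ominus>\<close>, the notation in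
  which the factor set conditions are stated.\<close>

sublocale add: group "add_monoid Q"
  rewrites "carrier (add_monoid Q) = carrier Q"
    and "monoid.mult (add_monoid Q) = ring.add Q"
    and "monoid.one (add_monoid Q) = ring.zero Q"
    and "m_inv (add_monoid Q) = a_inv Q"
  by (rule additive_group) (auto simp: a_inv_def)

sublocale circ: group Q by (rule circle_group)

lemma minus_closed [simp]: "x \<in> carrier Q \<Longrightarrow> y \<in> carrier Q \<Longrightarrow> x \<ominus> y \<in> carrier Q"
  by (simp add: a_minus_def)

text \<open>The pointwise group of all maps from Q x Q to K; \<open>Z2b\<close> is cut out of the
  square of this group.\<close>

abbreviation maps :: "('a \<times> 'a \<Rightarrow> 'k) monoid" where
  "maps \<equiv> product_group (carrier Q \<times> carrier Q) (\<lambda>_. K)"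

lemma group_maps: "group maps"
  by simp

lemma group_maps2: "group (maps \<times>\<times> maps)"
  by (intro DirProd_group group_maps)

lemma factor_sets_iff:
  "(\<alpha>, \<mu>) \<in> factor_sets Q K \<longleftrightarrow>
     \<alpha> \<in> carrier Q \<times> carrier Q \<rightarrow>\<^sub>E carrier K \<and>
     \<mu> \<in> carrier Q \<times> carrier Q \<rightarrow>\<^sub>E carrier K \<and>
     (\<forall>x \<in> carrier Q. \<forall>y \<in> carrier Q. \<forall>z \<in> carrier Q.
       \<alpha> (\<zero>, y) = \<one>\<^bsub>K\<^esub> \<and> \<alpha> (x, \<zero>) = \<one>\<^bsub>K\<^esub> \<and>
       \<mu> (\<zero>, y) = \<one>\<^bsub>K\<^esub> \<and> \<mu> (x, \<zero>) = \<one>\<^bsub>K\<^esub> \<and>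
       \<alpha> (y, z) \<otimes>\<^bsub>K\<^esub> \<alpha> (x, y \<oplus> z) = \<alpha> (x \<oplus> y, z) \<otimes>\<^bsub>K\<^esub> \<alpha> (x, y) \<and>
       \<mu> (y, z) \<otimes>\<^bsub>K\<^esub> \<mu> (x, y \<otimes> z) = \<mu> (x \<otimes> y, z) \<otimes>\<^bsub>K\<^esub> \<mu> (x, y) \<and>
       \<alpha> (y, z) \<otimes>\<^bsub>K\<^esub> \<mu> (x, y \<oplus> z) \<otimes>\<^bsub>K\<^esub> \<alpha> (\<ominus> x, x) =
         \<mu> (x, z) \<otimes>\<^bsub>K\<^esub> \<alpha> (x \<otimes> y, \<ominus> x) \<otimes>\<^bsub>K\<^esub> \<alpha> ((x \<otimes> y) \<ominus> x, x \<otimes> z) \<otimes>\<^bsub>K\<^esub> \<mu> (x, y))"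
proof -
  have "\<alpha> (y, z) \<otimes>\<^bsub>K\<^esub> inv\<^bsub>K\<^esub> \<alpha> (x \<oplus> y, z) \<otimes>\<^bsub>K\<^esub> \<alpha> (x, y \<oplus> z) \<otimes>\<^bsub>K\<^esub> inv\<^bsub>K\<^esub> \<alpha> (x, y) = \<one>\<^bsub>K\<^esub> \<longleftrightarrow>
      \<alpha> (y, z) \<otimes>\<^bsub>K\<^esub> \<alpha> (x, y \<oplus> z) = \<alpha> (x \<oplus> y, z) \<otimes>\<^bsub>K\<^esub> \<alpha> (x, y)"
    "\<mu> (y, z) \<otimes>\<^bsub>K\<^esub> inv\<^bsub>K\<^esub> \<mu> (x \<otimes> y, z) \<otimes>\<^bsub>K\<^esub> \<mu> (x, y \<otimes> z) \<otimes>\<^bsub>K\<^esub> inv\<^bsub>K\<^esub> \<mu> (x, y) = \<one>\<^bsub>K\<^esub> \<longleftrightarrow>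
      \<mu> (y, z) \<otimes>\<^bsub>K\<^esub> \<mu> (x, y \<otimes> z) = \<mu> (x \<otimes> y, z) \<otimes>\<^bsub>K\<^esub> \<mu> (x, y)"
    if "\<alpha> \<in> carrier Q \<times> carrier Q \<rightarrow>\<^sub>E carrier K" "\<mu> \<in> carrier Q \<times> carrier Q \<rightarrow>\<^sub>E carrier K"
      "x \<in> carrier Q" "y \<in> carrier Q" "z \<in> carrier Q" for x y z
    by (rule K.mult_inv_eq_one_iff; use that in \<open>auto simp: PiE_def Pi_def\<close>)+
  \<comment> \<open>The two equivalences presuppose values in K. The congruence rule
    \<open>conj_cong\<close> makes the first two conjuncts available while the others are
    rewritten.\<close>
  then show ?thesis
    unfolding factor_sets_def mem_Collect_eq prod.case by (auto cong: conj_cong)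
qed

lemma factor_sets_mem:
  assumes "(\<alpha>, \<mu>) \<in> factor_sets Q K" "x \<in> carrier Q" "y \<in> carrier Q"
  shows "\<alpha> (x, y) \<in> carrier K" "\<mu> (x, y) \<in> carrier K"
  using assms by (auto simp: factor_sets_iff)

lemma
  assumes "(\<alpha>, \<mu>) \<in> factor_sets Q K" "x \<in> carrier Q" "y \<in> carrier Q"
  shows factor_sets_zero:
      "\<alpha> (\<zero>, y) = \<one>\<^bsub>K\<^esub>" "\<alpha> (x, \<zero>) = \<one>\<^bsub>K\<^esub>" "\<mu> (\<zero>, y) = \<one>\<^bsub>K\<^esub>" "\<mu> (x, \<zero>) = \<one>\<^bsub>K\<^esub>"
    and factor_sets_cocycle:
      "z \<in> carrier Q \<Longrightarrow>
        \<alpha> (y, z) \<otimes>\<^bsub>K\<^esub> \<alpha> (x, y \<oplus> z) = \<alpha> (x \<oplus> y, z) \<otimes>\<^bsub>K\<^esub> \<alpha> (x, y)"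
      "z \<in> carrier Q \<Longrightarrow>
        \<mu> (y, z) \<otimes>\<^bsub>K\<^esub> \<mu> (x, y \<otimes> z) = \<mu> (x \<otimes> y, z) \<otimes>\<^bsub>K\<^esub> \<mu> (x, y)"
    and factor_sets_compat:
      "z \<in> carrier Q \<Longrightarrow>
        \<alpha> (y, z) \<otimes>\<^bsub>K\<^esub> \<mu> (x, y \<oplus> z) \<otimes>\<^bsub>K\<^esub> \<alpha> (\<ominus> x, x) =
          \<mu> (x, z) \<otimes>\<^bsub>K\<^esub> \<alpha> (x \<otimes> y, \<ominus> x) \<otimes>\<^bsub>K\<^esub> \<alpha> ((x \<otimes> y) \<ominus> x, x \<otimes> z) \<otimes>\<^bsub>K\<^esub> \<mu> (x, y)"
  using assms unfolding factor_sets_iff by blast+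

lemma one_maps2: "\<one>\<^bsub>maps \<times>\<times> maps\<^esub> \<in> factor_sets Q K"
  by (simp add: factor_sets_iff)

text \<open>Every condition is an equation between products in K. As K is abelian, the equations for
  the two factor sets can be multiplied and regrouped: \<open>interchange4\<close> does this for the
  cocycle identities, \<open>interchange7\<close> for the compatibility condition.\<close>

lemma mult_factor_sets:
  assumes "(\<alpha>, \<mu>) \<in> factor_sets Q K" "(\<alpha>', \<mu>') \<in> factor_sets Q K"
  shows "(\<alpha> \<otimes>\<^bsub>maps\<^esub> \<alpha>', \<mu> \<otimes>\<^bsub>maps\<^esub> \<mu>') \<in> factor_sets Q K"
proof -
  note c = factor_sets_mem[OF assms(1)] factor_sets_mem[OF assms(2)]
  have interchange4: "(a \<otimes>\<^bsub>K\<^esub> a') \<otimes>\<^bsub>K\<^esub> (b \<otimes>\<^bsub>K\<^esub> b') = (c \<otimes>\<^bsub>K\<^esub> c') \<otimes>\<^bsub>K\<^esub> (d \<otimes>\<^bsub>K\<^esub> d')"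
    if "a \<otimes>\<^bsub>K\<^esub> b = c \<otimes>\<^bsub>K\<^esub> d" "a' \<otimes>\<^bsub>K\<^esub> b' = c' \<otimes>\<^bsub>K\<^esub> d'"
      "{a, b, c, d, a', b', c', d'} \<subseteq> carrier K" for a b c d a' b' c' d'
  proof -
    have "(a \<otimes>\<^bsub>K\<^esub> a') \<otimes>\<^bsub>K\<^esub> (b \<otimes>\<^bsub>K\<^esub> b') = (a \<otimes>\<^bsub>K\<^esub> b) \<otimes>\<^bsub>K\<^esub> (a' \<otimes>\<^bsub>K\<^esub> b')"
      using that(3) by (simp add: K.m_ac)
    also have "\<dots> = (c \<otimes>\<^bsub>K\<^esub> d) \<otimes>\<^bsub>K\<^esub> (c' \<otimes>\<^bsub>K\<^esub> d')" using that by simp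
    also have "\<dots> = (c \<otimes>\<^bsub>K\<^esub> c') \<otimes>\<^bsub>K\<^esub> (d \<otimes>\<^bsub>K\<^esub> d')"
      using that(3) by (simp add: K.m_ac)
    finally show ?thesis .
  qed
  have interchange7: "(a \<otimes>\<^bsub>K\<^esub> a') \<otimes>\<^bsub>K\<^esub> (b \<otimes>\<^bsub>K\<^esub> b') \<otimes>\<^bsub>K\<^esub> (c \<otimes>\<^bsub>K\<^esub> c') =
      (d \<otimes>\<^bsub>K\<^esub> d') \<otimes>\<^bsub>K\<^esub> (e \<otimes>\<^bsub>K\<^esub> e') \<otimes>\<^bsub>K\<^esub> (f \<otimes>\<^bsub>K\<^esub> f') \<otimes>\<^bsub>K\<^esub> (g \<otimes>\<^bsub>K\<^esub> g')"
    if "a \<otimes>\<^bsub>K\<^esub> b \<otimes>\<^bsub>K\<^esub> c = d \<otimes>\<^bsub>K\<^esub> e \<otimes>\<^bsub>K\<^esub> f \<otimes>\<^bsub>K\<^esub> g"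
      "a' \<otimes>\<^bsub>K\<^esub> b' \<otimes>\<^bsub>K\<^esub> c' = d' \<otimes>\<^bsub>K\<^esub> e' \<otimes>\<^bsub>K\<^esub> f' \<otimes>\<^bsub>K\<^esub> g'"
      "{a, b, c, d, e, f, g, a', b', c', d', e', f', g'} \<subseteq> carrier K"
    for a b c d e f g a' b' c' d' e' f' g'
  proof -
    have "(a \<otimes>\<^bsub>K\<^esub> a') \<otimes>\<^bsub>K\<^esub> (b \<otimes>\<^bsub>K\<^esub> b') \<otimes>\<^bsub>K\<^esub> (c \<otimes>\<^bsub>K\<^esub> c') =
        (a \<otimes>\<^bsub>K\<^esub> b \<otimes>\<^bsub>K\<^esub> c) \<otimes>\<^bsub>K\<^esub> (a' \<otimes>\<^bsub>K\<^esub> b' \<otimes>\<^bsub>K\<^esub> c')"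
      using that(3) by (simp add: K.m_ac)
    also have "\<dots> = (d \<otimes>\<^bsub>K\<^esub> e \<otimes>\<^bsub>K\<^esub> f \<otimes>\<^bsub>K\<^esub> g) \<otimes>\<^bsub>K\<^esub> (d' \<otimes>\<^bsub>K\<^esub> e' \<otimes>\<^bsub>K\<^esub> f' \<otimes>\<^bsub>K\<^esub> g')"
      using that by simp
    also have "\<dots> = (d \<otimes>\<^bsub>K\<^esub> d') \<otimes>\<^bsub>K\<^esub> (e \<otimes>\<^bsub>K\<^esub> e') \<otimes>\<^bsub>K\<^esub> (f \<otimes>\<^bsub>K\<^esub> f') \<otimes>\<^bsub>K\<^esub> (g \<otimes>\<^bsub>K\<^esub> g')"
      using that(3) by (simp add: K.m_ac)
    finally show ?thesis .
  qed
  let ?a = "\<alpha> \<otimes>\<^bsub>maps\<^esub> \<alpha>'" and ?m = "\<mu> \<otimes>\<^bsub>maps\<^esub> \<mu>'"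
  show ?thesis
    unfolding factor_sets_iff
  proof (intro conjI ballI)
    fix x y z assume xyz: "x \<in> carrier Q" "y \<in> carrier Q" "z \<in> carrier Q"
    show "?a (y, z) \<otimes>\<^bsub>K\<^esub> ?a (x, y \<oplus> z) = ?a (x \<oplus> y, z) \<otimes>\<^bsub>K\<^esub> ?a (x, y)"
      using interchange4[OF factor_sets_cocycle(1)[OF assms(1) xyz] factor_sets_cocycle(1)[OF assms(2) xyz]]
      by (simp add: c xyz)
    show "?m (y, z) \<otimes>\<^bsub>K\<^esub> ?m (x, y \<otimes> z) = ?m (x \<otimes> y, z) \<otimes>\<^bsub>K\<^esub> ?m (x, y)"
      using interchange4[OF factor_sets_cocycle(2)[OF assms(1) xyz] factor_sets_cocycle(2)[OF assms(2) xyz]]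
      by (simp add: c xyz)
    show "?a (y, z) \<otimes>\<^bsub>K\<^esub> ?m (x, y \<oplus> z) \<otimes>\<^bsub>K\<^esub> ?a (\<ominus> x, x) =
        ?m (x, z) \<otimes>\<^bsub>K\<^esub> ?a (x \<otimes> y, \<ominus> x) \<otimes>\<^bsub>K\<^esub> ?a ((x \<otimes> y) \<ominus> x, x \<otimes> z) \<otimes>\<^bsub>K\<^esub> ?m (x, y)"
      using interchange7[OF factor_sets_compat[OF assms(1) xyz] factor_sets_compat[OF assms(2) xyz]]
      by (simp add: c xyz)
  qed (auto simp: c factor_sets_zero[OF assms(1)] factor_sets_zero[OF assms(2)])
qed

text \<open>Inversion is an endomorphism of the abelian group K, so it may be applied to each
  condition factor by factor.\<close>

lemma inv_factor_sets:
  assumes "(\<alpha>, \<mu>) \<in> factor_sets Q K"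
  shows "(inv\<^bsub>maps\<^esub> \<alpha>, inv\<^bsub>maps\<^esub> \<mu>) \<in> factor_sets Q K"
proof -
  note c = factor_sets_mem[OF assms]
  have inv7: "inv\<^bsub>K\<^esub> a \<otimes>\<^bsub>K\<^esub> inv\<^bsub>K\<^esub> b \<otimes>\<^bsub>K\<^esub> inv\<^bsub>K\<^esub> c =
      inv\<^bsub>K\<^esub> d \<otimes>\<^bsub>K\<^esub> inv\<^bsub>K\<^esub> e \<otimes>\<^bsub>K\<^esub> inv\<^bsub>K\<^esub> f \<otimes>\<^bsub>K\<^esub> inv\<^bsub>K\<^esub> g"
    if "a \<otimes>\<^bsub>K\<^esub> b \<otimes>\<^bsub>K\<^esub> c = d \<otimes>\<^bsub>K\<^esub> e \<otimes>\<^bsub>K\<^esub> f \<otimes>\<^bsub>K\<^esub> g"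
      "{a, b, c, d, e, f, g} \<subseteq> carrier K" for a b c d e f g
    using that by (simp flip: K.inv_mult)
  \<comment> \<open>The inverse in a product group is given pointwise only for members of the
    carrier, hence these memberships come first.\<close>
  have "\<alpha> \<in> carrier Q \<times> carrier Q \<rightarrow>\<^sub>E carrier K" "\<mu> \<in> carrier Q \<times> carrier Q \<rightarrow>\<^sub>E carrier K"
    using assms by (simp_all add: factor_sets_iff)
  then have i: "inv\<^bsub>maps\<^esub> \<alpha> = (\<lambda>i\<in>carrier Q \<times> carrier Q. inv\<^bsub>K\<^esub> \<alpha> i)"
    "inv\<^bsub>maps\<^esub> \<mu> = (\<lambda>i\<in>carrier Q \<times> carrier Q. inv\<^bsub>K\<^esub> \<mu> i)"
    by simp_all
  let ?a = "\<lambda>i\<in>carrier Q \<times> carrier Q. inv\<^bsub>K\<^esub> \<alpha> i" and ?m = "\<lambda>i\<in>carrier Q \<times> carrier Q. inv\<^bsub>K\<^esub> \<mu> i"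
  show ?thesis
    unfolding factor_sets_iff i
  proof (intro conjI ballI)
    fix x y z assume xyz: "x \<in> carrier Q" "y \<in> carrier Q" "z \<in> carrier Q"
    show "?a (y, z) \<otimes>\<^bsub>K\<^esub> ?a (x, y \<oplus> z) = ?a (x \<oplus> y, z) \<otimes>\<^bsub>K\<^esub> ?a (x, y)"
      using K.inv_mult_inv_cong[OF _ _ _ _ factor_sets_cocycle(1)[OF assms xyz]] by (simp add: c xyz)
    show "?m (y, z) \<otimes>\<^bsub>K\<^esub> ?m (x, y \<otimes> z) = ?m (x \<otimes> y, z) \<otimes>\<^bsub>K\<^esub> ?m (x, y)"
      using K.inv_mult_inv_cong[OF _ _ _ _ factor_sets_cocycle(2)[OF assms xyz]] by (simp add: c xyz)
    show "?a (y, z) \<otimes>\<^bsub>K\<^esub> ?m (x, y \<oplus> z) \<otimes>\<^bsub>K\<^esub> ?a (\<ominus> x, x) =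
        ?m (x, z) \<otimes>\<^bsub>K\<^esub> ?a (x \<otimes> y, \<ominus> x) \<otimes>\<^bsub>K\<^esub> ?a ((x \<otimes> y) \<ominus> x, x \<otimes> z) \<otimes>\<^bsub>K\<^esub> ?m (x, y)"
      using inv7[OF factor_sets_compat[OF assms xyz]] by (simp add: c xyz)
  qed (auto simp: c factor_sets_zero[OF assms])
qed

section \<open>The abelian group of factor sets\<close>

lemma subgroup_factor_sets: "subgroup (factor_sets Q K) (maps \<times>\<times> maps)"
proof (rule group.subgroupI[OF group_maps2])
  show "factor_sets Q K \<subseteq> carrier (maps \<times>\<times> maps)"
    by (auto simp: factor_sets_def)
  show "factor_sets Q K \<noteq> {}" using one_maps2 by blast
  fix a assume a: "a \<in> factor_sets Q K"
  then have "fst a \<in> carrier maps" "snd a \<in> carrier maps"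
    by (auto simp: factor_sets_def)
  then show "inv\<^bsub>maps \<times>\<times> maps\<^esub> a \<in> factor_sets Q K"
    using inv_factor_sets[of "fst a" "snd a"] inv_DirProd[OF group_maps group_maps, of "fst a" "snd a"] a
    by simp
  fix b assume b: "b \<in> factor_sets Q K"
  show "a \<otimes>\<^bsub>maps \<times>\<times> maps\<^esub> b \<in> factor_sets Q K"
    using mult_factor_sets[of "fst a" "snd a" "fst b" "snd b"] a b
    by (simp add: mult_DirProd')
qed

lemma carrier_Z2b [simp]: "carrier (Z2b Q K) = factor_sets Q K"
  by (simp add: Z2b_def)

lemma mult_Z2b:
  "(\<alpha>, \<mu>) \<otimes>\<^bsub>Z2b Q K\<^esub> (\<alpha>', \<mu>') =
    (\<lambda>p \<in> carrier Q \<times> carrier Q. \<alpha> p \<otimes>\<^bsub>K\<^esub> \<alpha>' p, \<lambda>p \<in> carrier Q \<times> carrier Q. \<mu> p \<otimes>\<^bsub>K\<^esub> \<mu>' p)"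
  by (simp add: Z2b_def)

lemma one_Z2b:
  "\<one>\<^bsub>Z2b Q K\<^esub> = (\<lambda>p \<in> carrier Q \<times> carrier Q. \<one>\<^bsub>K\<^esub>, \<lambda>p \<in> carrier Q \<times> carrier Q. \<one>\<^bsub>K\<^esub>)"
  by (simp add: Z2b_def)

lemma comm_group_Z2b: "comm_group (Z2b Q K)"
proof (rule group.group_comm_groupI)
  show "group (Z2b Q K)"
    \<comment> \<open>\<open>Z2b\<close> is the product group with its carrier replaced, exactly the
      form in which a subgroup is a group of its own.\<close>
    unfolding Z2b_def by (rule subgroup.subgroup_is_group[OF subgroup_factor_sets group_maps2])
  fix a b assume "a \<in> carrier (Z2b Q K)" "b \<in> carrier (Z2b Q K)"
  then show "a \<otimes>\<^bsub>Z2b Q K\<^esub> b = b \<otimes>\<^bsub>Z2b Q K\<^esub> a"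
    by (cases a; cases b) (auto simp: mult_Z2b factor_sets_mem intro!: restrict_ext K.m_comm)
qed

sublocale Z: comm_group "Z2b Q K" by (rule comm_group_Z2b)

lemma pow_Z2b:
  fixes n :: nat
  assumes "(\<alpha>, \<mu>) \<in> factor_sets Q K"
  shows "(\<alpha>, \<mu>) [^]\<^bsub>Z2b Q K\<^esub> n =
    (\<lambda>p \<in> carrier Q \<times> carrier Q. \<alpha> p [^]\<^bsub>K\<^esub> n, \<lambda>p \<in> carrier Q \<times> carrier Q. \<mu> p [^]\<^bsub>K\<^esub> n)"
proof (induction n)
  case 0
  show ?case by (auto simp: one_Z2b restrict_def)
next
  case (Suc n)
  then show ?case by (auto simp: mult_Z2b intro!: restrict_ext)
qed

section \<open>Coboundaries\<close>

text \<open>After expansion into values of \<open>h\<close>, the values at intermediate sums and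
  products cancel against their inverses. The brace axiom enters only to match the outermost
  arguments in the compatibility condition.\<close>

lemma coboundary_factor_set:
  assumes h: "h \<in> carrier Q \<rightarrow> carrier K" and h0: "h \<zero> = \<one>\<^bsub>K\<^esub>"
  shows "(d_add Q K h, d_circ Q K h) \<in> factor_sets Q K"
proof -
  have hc [simp]: "h x \<in> carrier K" if "x \<in> carrier Q" for x using h that by auto
  \<comment> \<open>Here \<open>c\<close> stands for the value of \<open>h\<close> at the sum or
    product of the points where \<open>h\<close> takes the values \<open>a\<close> and
    \<open>b\<close>. Treating the three as independent elements of K reduces the claims to
    identities in an abelian group.\<close>
  define d where "d a b c = b \<otimes>\<^bsub>K\<^esub> inv\<^bsub>K\<^esub> c \<otimes>\<^bsub>K\<^esub> a" for a b c
  have dc [simp]: "d a b c \<in> carrier K"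
    if "a \<in> carrier K" "b \<in> carrier K" "c \<in> carrier K" for a b c
    using that by (simp add: d_def)
  have d1 [simp]: "d a \<one>\<^bsub>K\<^esub> a = \<one>\<^bsub>K\<^esub>" "d \<one>\<^bsub>K\<^esub> a a = \<one>\<^bsub>K\<^esub>"
    if "a \<in> carrier K" for a
    using that by (simp_all add: d_def)
  \<comment> \<open>The names \<open>ab\<close>, \<open>bc\<close>, \<open>abc\<close> denote free
    variables, so this one identity serves both the additive and the circle cocycle
    condition.\<close>
  have cocycle: "d b c bc \<otimes>\<^bsub>K\<^esub> d a bc abc = d ab c abc \<otimes>\<^bsub>K\<^esub> d a b ab"
    if "{a, b, c, ab, bc, abc} \<subseteq> carrier K" for a b c ab bc abc
  proof -
    have "d b c bc \<otimes>\<^bsub>K\<^esub> d a bc abc =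
        (bc \<otimes>\<^bsub>K\<^esub> inv\<^bsub>K\<^esub> bc) \<otimes>\<^bsub>K\<^esub> (a \<otimes>\<^bsub>K\<^esub> b \<otimes>\<^bsub>K\<^esub> c \<otimes>\<^bsub>K\<^esub> inv\<^bsub>K\<^esub> abc)"
      using that by (simp only: d_def insert_subset K.m_ac K.m_closed K.inv_closed)
    also have "\<dots> = (ab \<otimes>\<^bsub>K\<^esub> inv\<^bsub>K\<^esub> ab) \<otimes>\<^bsub>K\<^esub> (a \<otimes>\<^bsub>K\<^esub> b \<otimes>\<^bsub>K\<^esub> c \<otimes>\<^bsub>K\<^esub> inv\<^bsub>K\<^esub> abc)"
      using that by simp
    also have "\<dots> = d ab c abc \<otimes>\<^bsub>K\<^esub> d a b ab"
      using that by (simp only: d_def insert_subset K.m_ac K.m_closed K.inv_closed)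
    finally show ?thesis .
  qed
  \<comment> \<open>The variables \<open>x'\<close>, \<open>t\<close> and \<open>w\<close> stand for
    the values of \<open>h\<close> at -x, at x o y - x and at x o (y + z); the argument
    \<open>\<one>\<close> is the value at -x + x. What remains on both sides after cancellation is
    \<open>?r\<close>.\<close>
  have compat: "d y z yz \<otimes>\<^bsub>K\<^esub> d x yz w \<otimes>\<^bsub>K\<^esub> d x' x \<one>\<^bsub>K\<^esub> =
      d x z xz \<otimes>\<^bsub>K\<^esub> d xy x' t \<otimes>\<^bsub>K\<^esub> d t xz w \<otimes>\<^bsub>K\<^esub> d x y xy"
    if "{x, y, z, x', yz, w, xz, xy, t} \<subseteq> carrier K" for x y z x' yz w xz xy t
  proof -
    let ?r = "x \<otimes>\<^bsub>K\<^esub> x \<otimes>\<^bsub>K\<^esub> y \<otimes>\<^bsub>K\<^esub> z \<otimes>\<^bsub>K\<^esub> x' \<otimes>\<^bsub>K\<^esub> inv\<^bsub>K\<^esub> w"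
    have "d y z yz \<otimes>\<^bsub>K\<^esub> d x yz w \<otimes>\<^bsub>K\<^esub> d x' x \<one>\<^bsub>K\<^esub> = (yz \<otimes>\<^bsub>K\<^esub> inv\<^bsub>K\<^esub> yz) \<otimes>\<^bsub>K\<^esub> ?r"
      using that by (simp only: d_def insert_subset K.inv_one K.one_closed K.r_one K.m_ac K.m_closed K.inv_closed)
    also have "\<dots> =
        (xz \<otimes>\<^bsub>K\<^esub> inv\<^bsub>K\<^esub> xz) \<otimes>\<^bsub>K\<^esub> (xy \<otimes>\<^bsub>K\<^esub> inv\<^bsub>K\<^esub> xy) \<otimes>\<^bsub>K\<^esub> (t \<otimes>\<^bsub>K\<^esub> inv\<^bsub>K\<^esub> t) \<otimes>\<^bsub>K\<^esub> ?r"
      using that by simp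
    also have "\<dots> = d x z xz \<otimes>\<^bsub>K\<^esub> d xy x' t \<otimes>\<^bsub>K\<^esub> d t xz w \<otimes>\<^bsub>K\<^esub> d x y xy"
      using that by (simp only: d_def insert_subset K.m_ac K.m_closed K.inv_closed)
    finally show ?thesis .
  qed
  have a: "d_add Q K h = (\<lambda>(x, y) \<in> carrier Q \<times> carrier Q. d (h x) (h y) (h (x \<oplus> y)))"
    and m: "d_circ Q K h = (\<lambda>(x, y) \<in> carrier Q \<times> carrier Q. d (h x) (h y) (h (x \<otimes> y)))"
    by (simp_all add: d_add_def d_circ_def d_def)
  \<comment> \<open>The normalisation of \<open>d_circ\<close> is required at
    \<open>\<zero>\<close>, which is also the neutral element of the circle group.\<close>
  have unit [simp]: "\<zero> \<otimes> x = x" "x \<otimes> \<zero> = x" if "x \<in> carrier Q" for x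
    using that by (simp_all add: zero_eq_one)
  show ?thesis
    unfolding factor_sets_iff
  proof (intro conjI ballI)
    fix x y z assume xyz: "x \<in> carrier Q" "y \<in> carrier Q" "z \<in> carrier Q"
    \<comment> \<open>By the brace axiom, \<open>h\<close> is evaluated at the same point in both
      occurrences of \<open>w\<close> in \<open>compat\<close>.\<close>
    have 1: "(x \<otimes> y) \<ominus> x \<oplus> x \<otimes> z = x \<otimes> (y \<oplus> z)" using brace xyz by simp
    have 2: "x \<otimes> y \<oplus> \<ominus> x = (x \<otimes> y) \<ominus> x" by (simp add: a_minus_def)
    show "d_add Q K h (y, z) \<otimes>\<^bsub>K\<^esub> d_circ Q K h (x, y \<oplus> z) \<otimes>\<^bsub>K\<^esub> d_add Q K h (\<ominus> x, x) =
      d_circ Q K h (x, z) \<otimes>\<^bsub>K\<^esub> d_add Q K h (x \<otimes> y, \<ominus> x) \<otimes>\<^bsub>K\<^esub>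
        d_add Q K h ((x \<otimes> y) \<ominus> x, x \<otimes> z) \<otimes>\<^bsub>K\<^esub> d_circ Q K h (x, y)"
      using xyz compat by (simp add: a m h0 1 2)
    show "d_add Q K h (y, z) \<otimes>\<^bsub>K\<^esub> d_add Q K h (x, y \<oplus> z) =
        d_add Q K h (x \<oplus> y, z) \<otimes>\<^bsub>K\<^esub> d_add Q K h (x, y)"
      using xyz cocycle by (simp add: a add.m_assoc)
    show "d_circ Q K h (y, z) \<otimes>\<^bsub>K\<^esub> d_circ Q K h (x, y \<otimes> z) =
        d_circ Q K h (x \<otimes> y, z) \<otimes>\<^bsub>K\<^esub> d_circ Q K h (x, y)"
      using xyz cocycle by (simp add: m circ.m_assoc)
  qed (auto simp: a m h0)
qed

text \<open>Sending \<open>h\<close> to its pair of coboundaries is multiplicative (the fact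
  \<open>mult\<close>), so products and inverses in \<open>B2b\<close> come from pointwise products
  and inverses of the maps \<open>h\<close>.\<close>

lemma subgroup_B2b: "subgroup (B2b Q K) (Z2b Q K)"
proof (rule Z.subgroupI)
  show "B2b Q K \<subseteq> carrier (Z2b Q K)"
    by (auto simp: B2b_def coboundary_factor_set)
  have "(d_add Q K (\<lambda>_. \<one>\<^bsub>K\<^esub>), d_circ Q K (\<lambda>_. \<one>\<^bsub>K\<^esub>)) \<in> B2b Q K"
    unfolding B2b_def by blast
  then show "B2b Q K \<noteq> {}" by blast
  have mult: "(d_add Q K h, d_circ Q K h) \<otimes>\<^bsub>Z2b Q K\<^esub> (d_add Q K h', d_circ Q K h') =
      (d_add Q K (\<lambda>x. h x \<otimes>\<^bsub>K\<^esub> h' x), d_circ Q K (\<lambda>x. h x \<otimes>\<^bsub>K\<^esub> h' x))"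
    if "h \<in> carrier Q \<rightarrow> carrier K" "h' \<in> carrier Q \<rightarrow> carrier K" for h h'
  proof -
    have "h x \<in> carrier K" "h' x \<in> carrier K" if "x \<in> carrier Q" for x
      using that \<open>h \<in> _\<close> \<open>h' \<in> _\<close> by auto
    then show ?thesis
      by (auto simp: mult_Z2b d_add_def d_circ_def K.inv_mult K.m_ac intro!: restrict_ext)
  qed
  fix a assume "a \<in> B2b Q K"
  then obtain h where a: "a = (d_add Q K h, d_circ Q K h)"
    and h: "h \<in> carrier Q \<rightarrow> carrier K" "h \<zero> = \<one>\<^bsub>K\<^esub>"
    by (auto simp: B2b_def)
  let ?i = "\<lambda>x. inv\<^bsub>K\<^esub> h x"
  have i: "?i \<in> carrier Q \<rightarrow> carrier K" "?i \<zero> = \<one>\<^bsub>K\<^esub>" using h by auto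
  have hc: "h x \<in> carrier K" if "x \<in> carrier Q" for x using h that by auto
  have "(d_add Q K ?i, d_circ Q K ?i) \<otimes>\<^bsub>Z2b Q K\<^esub> a = \<one>\<^bsub>Z2b Q K\<^esub>"
    unfolding a mult[OF i(1) h(1)] one_Z2b
    by (auto simp: d_add_def d_circ_def hc intro!: restrict_ext)
  then have "inv\<^bsub>Z2b Q K\<^esub> a = (d_add Q K ?i, d_circ Q K ?i)"
    using i h by (intro Z.inv_equality) (auto simp: a coboundary_factor_set)
  then show "inv\<^bsub>Z2b Q K\<^esub> a \<in> B2b Q K" using i by (auto simp: B2b_def)
  fix b assume "b \<in> B2b Q K"
  then obtain h' where b: "b = (d_add Q K h', d_circ Q K h')"
    and h': "h' \<in> carrier Q \<rightarrow> carrier K" "h' \<zero> = \<one>\<^bsub>K\<^esub>"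
    by (auto simp: B2b_def)
  have "(\<lambda>x. h x \<otimes>\<^bsub>K\<^esub> h' x) \<in> carrier Q \<rightarrow> carrier K" "h \<zero> \<otimes>\<^bsub>K\<^esub> h' \<zero> = \<one>\<^bsub>K\<^esub>"
    using h h' by auto
  then show "a \<otimes>\<^bsub>Z2b Q K\<^esub> b \<in> B2b Q K"
    unfolding a b mult[OF h(1) h'(1)] B2b_def by blast
qed

sublocale B: normal "B2b Q K" "Z2b Q K"
  by (rule Z.subgroup_imp_normal[OF subgroup_B2b])

section \<open>Powers of factor sets by the order of Q\<close>

text \<open>With \<alpha> trivial, each \<open>\<mu> (x, -)\<close> is a homomorphism on the
  additive group. The |Q|-th power of a value is then the value at the |Q|-fold sum of
  \<open>y\<close>, which is \<open>\<zero>\<close> by Lagrange, and \<mu> is normalised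
  there.\<close>

lemma pow_card_trivial_additive:
  assumes f: "(\<alpha>, \<mu>) \<in> factor_sets Q K" and fin: "finite (carrier Q)"
    and triv: "\<And>x y. \<lbrakk>x \<in> carrier Q; y \<in> carrier Q\<rbrakk> \<Longrightarrow> \<alpha> (x, y) = \<one>\<^bsub>K\<^esub>"
  shows "(\<alpha>, \<mu>) [^]\<^bsub>Z2b Q K\<^esub> card (carrier Q) = \<one>\<^bsub>Z2b Q K\<^esub>"
proof -
  have "\<mu> (x, y) [^]\<^bsub>K\<^esub> card (carrier Q) = \<one>\<^bsub>K\<^esub>"
    if x: "x \<in> carrier Q" and y: "y \<in> carrier Q" for x y
  proof -
    have "(\<lambda>y. \<mu> (x, y)) \<in> hom (add_monoid Q) K"
    proof (rule homI)
      fix u v assume "u \<in> carrier (add_monoid Q)" "v \<in> carrier (add_monoid Q)"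
      then have uv: "u \<in> carrier Q" "v \<in> carrier Q" by auto
      show "\<mu> (x, u \<otimes>\<^bsub>add_monoid Q\<^esub> v) = \<mu> (x, u) \<otimes>\<^bsub>K\<^esub> \<mu> (x, v)"
        \<comment> \<open>The compatibility condition yields the two factors in the opposite order;
          commutativity of K swaps them.\<close>
        using factor_sets_compat[OF f x uv] x uv factor_sets_mem[OF f] by (simp add: triv K.m_comm)
    qed (use f x factor_sets_mem in auto)
    then have \<mu>: "group_hom (add_monoid Q) K (\<lambda>y. \<mu> (x, y))"
      by (simp add: group_hom_def group_hom_axioms_def additive_group K.is_group)
    have "\<mu> (x, y) [^]\<^bsub>K\<^esub> card (carrier Q) = \<mu> (x, y [^]\<^bsub>add_monoid Q\<^esub> card (carrier Q))"
      using group_hom.hom_nat_pow[OF \<mu>, of y] y by simp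
    also have "y [^]\<^bsub>add_monoid Q\<^esub> card (carrier Q) = \<zero>"
      using group.pow_order_eq_1[OF additive_group, of y] fin y by (simp add: Coset.order_def)
    also have "\<mu> (x, \<zero>) = \<one>\<^bsub>K\<^esub>" by (rule factor_sets_zero(4)[OF f x x])
    finally show ?thesis .
  qed
  then show ?thesis
    by (auto simp: pow_Z2b[OF f] one_Z2b triv intro!: restrict_ext)
qed

text \<open>This is the averaging argument of group cohomology without the division: in the product
  of the cocycle identities over their first argument, the factor independent of that argument
  contributes its |Q|-th power.\<close>

lemma additive_pow_card:
  assumes f: "(\<alpha>, \<mu>) \<in> factor_sets Q K" and fin: "finite (carrier Q)"
  obtains h where "h \<in> carrier Q \<rightarrow> carrier K" "h \<zero> = \<one>\<^bsub>K\<^esub>"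
    "\<And>x y. \<lbrakk>x \<in> carrier Q; y \<in> carrier Q\<rbrakk> \<Longrightarrow> \<alpha> (x, y) [^]\<^bsub>K\<^esub> card (carrier Q) = d_add Q K h (x, y)"
proof
  note [simp] = factor_sets_mem[OF f]
  define h where "h y = (\<Otimes>\<^bsub>K\<^esub>x\<in>carrier Q. \<alpha> (x, y))" for y
  show hc: "h \<in> carrier Q \<rightarrow> carrier K"
    by (auto simp: h_def intro!: K.finprod_closed)
  show "h \<zero> = \<one>\<^bsub>K\<^esub>"
    unfolding h_def by (rule K.finprod_one_eqI) (simp add: factor_sets_zero[OF f])
  fix y z assume y: "y \<in> carrier Q" and z: "z \<in> carrier Q"
  have c: "h y \<in> carrier K" "h z \<in> carrier K" "h (y \<oplus> z) \<in> carrier K"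
    using hc y z by auto
  \<comment> \<open>Right translation by \<open>y\<close> permutes the finite set Q, so it only
    reindexes the product.\<close>
  have shift: "(\<Otimes>\<^bsub>K\<^esub>x\<in>carrier Q. \<alpha> (x \<oplus> y, z)) = h z"
  proof -
    have inj: "inj_on (\<lambda>x. x \<oplus> y) (carrier Q)" using y by (simp add: inj_on_def)
    have "(\<lambda>x. x \<oplus> y) ` carrier Q = carrier Q"
      using y by (intro endo_inj_surj[OF fin _ inj]) auto
    then show ?thesis
      using K.finprod_reindex[OF _ inj, of "\<lambda>x. \<alpha> (x, z)"] y z by (simp add: h_def Pi_def)
  qed
  have "\<alpha> (y, z) [^]\<^bsub>K\<^esub> card (carrier Q) \<otimes>\<^bsub>K\<^esub> h (y \<oplus> z) =
      (\<Otimes>\<^bsub>K\<^esub>x\<in>carrier Q. \<alpha> (y, z) \<otimes>\<^bsub>K\<^esub> \<alpha> (x, y \<oplus> z))"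
    using y z by (subst K.finprod_multf) (auto simp: h_def K.finprod_const)
  also have "\<dots> = (\<Otimes>\<^bsub>K\<^esub>x\<in>carrier Q. \<alpha> (x \<oplus> y, z) \<otimes>\<^bsub>K\<^esub> \<alpha> (x, y))"
    using y z by (intro K.finprod_cong') (auto simp: factor_sets_cocycle[OF f])
  also have "\<dots> = h z \<otimes>\<^bsub>K\<^esub> h y"
    using y z by (subst K.finprod_multf) (auto simp: shift h_def)
  finally have "\<alpha> (y, z) [^]\<^bsub>K\<^esub> card (carrier Q) = h z \<otimes>\<^bsub>K\<^esub> h y \<otimes>\<^bsub>K\<^esub> inv\<^bsub>K\<^esub> h (y \<oplus> z)"
    using y z c by (intro K.inv_solve_right[THEN iffD2]) auto
  then show "\<alpha> (y, z) [^]\<^bsub>K\<^esub> card (carrier Q) = d_add Q K h (y, z)"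
    using y z c by (simp add: d_add_def K.m_ac)
qed

text \<open>The power \<open>z [^] ?n\<close> is split as \<open>w\<close> times a coboundary
  \<open>b\<close> with the same additive component, so that \<open>w\<close> has trivial additive
  component and dies in the next |Q|-th power.\<close>

lemma pow_card_square_B2b:
  assumes f: "z \<in> factor_sets Q K" and fin: "finite (carrier Q)"
  shows "z [^]\<^bsub>Z2b Q K\<^esub> (card (carrier Q))\<^sup>2 \<in> B2b Q K"
proof -
  let ?n = "card (carrier Q)"
  obtain \<alpha> \<mu> where z: "z = (\<alpha>, \<mu>)" by fastforce
  obtain h where h: "h \<in> carrier Q \<rightarrow> carrier K" "h \<zero> = \<one>\<^bsub>K\<^esub>"
    and pow: "\<And>x y. \<lbrakk>x \<in> carrier Q; y \<in> carrier Q\<rbrakk> \<Longrightarrow> \<alpha> (x, y) [^]\<^bsub>K\<^esub> ?n = d_add Q K h (x, y)"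
    using additive_pow_card[of \<alpha> \<mu>] f fin z by blast
  define b where "b = (d_add Q K h, d_circ Q K h)"
  have b: "b \<in> B2b Q K" using h by (auto simp: b_def B2b_def)
  then have bZ: "b \<in> carrier (Z2b Q K)" by (rule B.mem_carrier)
  have zZ: "z \<in> carrier (Z2b Q K)" using f by simp
  define w where "w = z [^]\<^bsub>Z2b Q K\<^esub> ?n \<otimes>\<^bsub>Z2b Q K\<^esub> inv\<^bsub>Z2b Q K\<^esub> b"
  have wZ: "w \<in> carrier (Z2b Q K)" using zZ bZ unfolding w_def by blast
  have zn: "z [^]\<^bsub>Z2b Q K\<^esub> ?n = w \<otimes>\<^bsub>Z2b Q K\<^esub> b"
    using zZ bZ by (simp add: w_def Z.m_assoc del: carrier_Z2b)
  obtain \<beta> \<nu> where w: "w = (\<beta>, \<nu>)" by fastforce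
  \<comment> \<open>The additive components of both sides of \<open>zn\<close> are compared;
    \<open>d_add Q K h\<close> appears on each and cancels.\<close>
  have "\<beta> (x, y) = \<one>\<^bsub>K\<^esub>" if xy: "x \<in> carrier Q" "y \<in> carrier Q" for x y
  proof -
    have "fst (z [^]\<^bsub>Z2b Q K\<^esub> ?n) (x, y) = d_add Q K h (x, y)"
      using f z xy by (simp add: pow_Z2b pow)
    moreover have "fst (w \<otimes>\<^bsub>Z2b Q K\<^esub> b) (x, y) = \<beta> (x, y) \<otimes>\<^bsub>K\<^esub> d_add Q K h (x, y)"
      using xy by (simp add: w b_def mult_Z2b)
    moreover have "d_add Q K h (x, y) \<in> carrier K" "\<beta> (x, y) \<in> carrier K"
      using factor_sets_mem xy bZ wZ by (auto simp: b_def w)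
    ultimately show ?thesis using zn K.r_cancel_one by metis
  qed
  then have wn: "w [^]\<^bsub>Z2b Q K\<^esub> ?n = \<one>\<^bsub>Z2b Q K\<^esub>"
    using pow_card_trivial_additive fin wZ unfolding w by simp
  have "z [^]\<^bsub>Z2b Q K\<^esub> ?n\<^sup>2 = (z [^]\<^bsub>Z2b Q K\<^esub> ?n) [^]\<^bsub>Z2b Q K\<^esub> ?n"
    using zZ by (simp add: Z.nat_pow_pow power2_eq_square del: carrier_Z2b)
  \<comment> \<open>The power distributes over the product because \<open>Z2b\<close> is
    abelian.\<close>
  also have "\<dots> = w [^]\<^bsub>Z2b Q K\<^esub> ?n \<otimes>\<^bsub>Z2b Q K\<^esub> b [^]\<^bsub>Z2b Q K\<^esub> ?n"
    unfolding zn using wZ bZ by (intro Z.pow_mult_distrib Z.m_comm)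
  also have "\<dots> = b [^]\<^bsub>Z2b Q K\<^esub> ?n" using wn bZ by (simp del: carrier_Z2b)
  also have "\<dots> \<in> B2b Q K"
  proof -
    have "b [^]\<^bsub>Z2b Q K\<^esub> k \<in> B2b Q K" for k :: nat
      by (induction k) (auto simp: b)
    then show ?thesis .
  qed
  finally show ?thesis .
qed

section \<open>The exponent of the second cohomology group\<close>

lemma group_exponent_H2b_dvd:
  assumes fin: "finite (carrier Q)"
  shows "group_exponent (H2b Q K) dvd (card (carrier Q))\<^sup>2"
proof -
  interpret H: group "H2b Q K"
    unfolding H2b_def by (rule B.factorgroup_is_group)
  \<comment> \<open>As the projection onto cosets is a homomorphism, powers in the quotient can be
    computed on representatives.\<close>
  interpret p: group_hom "Z2b Q K" "H2b Q K" "\<lambda>a. B2b Q K #>\<^bsub>Z2b Q K\<^esub> a"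
    by (intro group_hom.intro group_hom_axioms.intro H.is_group Z.is_group)
      (simp add: H2b_def B.r_coset_hom_Mod)
  show ?thesis
  proof (rule H.group_exponent_dvd)
    \<comment> \<open>Only positive periods count for \<open>group_exponent\<close>; the order is
      positive since Q is finite and contains \<open>\<one>\<close>.\<close>
    show "(card (carrier Q))\<^sup>2 > 0"
      using fin circ.one_closed by (auto simp: card_gt_0_iff)
    fix x assume "x \<in> carrier (H2b Q K)"
    then obtain z where z: "z \<in> carrier (Z2b Q K)" and x: "x = B2b Q K #>\<^bsub>Z2b Q K\<^esub> z"
      by (auto simp: H2b_def FactGroup_def RCOSETS_def)
    have "x [^]\<^bsub>H2b Q K\<^esub> (card (carrier Q))\<^sup>2 =
        B2b Q K #>\<^bsub>Z2b Q K\<^esub> (z [^]\<^bsub>Z2b Q K\<^esub> (card (carrier Q))\<^sup>2)"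
      unfolding x using z by (rule p.hom_nat_pow[symmetric])
    \<comment> \<open>The coset of a member of \<open>B2b\<close> is \<open>B2b\<close> itself, the
      neutral element of the quotient.\<close>
    also have "\<dots> = B2b Q K"
      using pow_card_square_B2b[of z] z fin
      by (intro Z.coset_join2 B.subgroup_axioms Z.nat_pow_closed) auto
    finally show "x [^]\<^bsub>H2b Q K\<^esub> (card (carrier Q))\<^sup>2 = \<one>\<^bsub>H2b Q K\<^esub>"
      by (simp add: H2b_def FactGroup_def)
  qed
qed

end

theorem theorem2p2:
  fixes Q :: "('a, 'm) ring_scheme"
  assumes "skew_brace Q" and "finite (carrier Q)"
  shows "group_exponent (Schur_multiplier Q) dvd (card (carrier Q))\<^sup>2"
proof -
  interpret C: cring "ring_of_type_algebra :: complex ring" by (rule cring_from_type_algebra)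
  \<comment> \<open>Specialisation to the multiplicative group of the complex numbers, which is
    abelian as the unit group of a commutative ring.\<close>
  interpret brace_coefficients Q "units_of (ring_of_type_algebra :: complex ring)"
    by (intro brace_coefficients.intro assms(1) C.units_comm_group)
  show ?thesis
    unfolding Schur_multiplier_def by (rule group_exponent_H2b_dvd[OF assms(2)])
qed

end
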